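(* Let $\mathbb{F}$ be a field with $\operatorname{char}(\mathbb{F})\ne 2$, let $n\ge 1$, and let $\mathfrak{k}_n$ be the Kronecker Leibniz algebra over $\mathbb{F}$ with its basis $\{e_1,\dots,e_n,f_1,\dots,f_n,z\}$. A linear endomorphism $d\colon\mathfrak{k}_n\to\mathfrak{k}_n$ is a derivation if and only if its matrix with respect to this basis has the form $$\begin{pmatrix} A & C & 0\\ B & D & 0\\ \mu & \nu & \gamma\end{pmatrix},$$ where $\mu=(\mu_1,\dots,\mu_n)$ and $\nu=(\nu_1,\dots,\nu_n)$ are arbitrary row vectors in $\mathbb{F}^n$, and, for some scalars $\alpha_1,\dots,\alpha_n,\beta_1\in\mathbb{F}$, $b_h\in\mathbb{F}$ ($h$ odd, $n+1\le h\le 2n-1$) and $c_h\in\mathbb{F}$ ($h$ odd, $3\le h\le n+1$), one has $\gamma=\alpha_1+\beta_1$ and the $n\times n$ blocks have entries as follows: (i) $A$ is upper triangular Toeplitz: $A_{ij}=\alpha_{j-i+1}$ if $i\le j$ and $A_{ij}=0$ if $i>j$; (ii) $D$ is lower triangular Toeplitz: $D_{ii}=\beta_1$, $D_{ij}=-\alpha_{i-j+1}$ if $i>j$, and $D_{ij}=0$ if $i<j$; (iii) $B_{ij}=(-1)^{i+1}b_{i+j}$ if $i+j$ is odd and $i+j\ge n+1$, and $B_{ij}=0$ otherwise; (iv) $C_{ij}=(-1)^{i+1}c_{i+j}$ if $i+j$ is odd and $i+j\le n+1$, and $C_{ij}=0$ otherwise.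
   Context: The Kronecker Leibniz algebra $\mathfrak{k}_n$ is the $(2n+1)$-dimensional algebra over $\mathbb{F}$ with basis $\{e_1,\dots,e_n,f_1,\dots,f_n,z\}$ and bilinear bracket whose nonzero values on basis elements are $[e_i,f_i]=[f_i,e_i]=z$ for $i=1,\dots,n$, and $[e_i,f_{i-1}]=z$, $[f_{i-1},e_i]=-z$ for $i=2,\dots,n$. A derivation of an algebra $L$ with bracket $[-,-]$ is a linear map $d\colon L\to L$ with $d([x,y])=[d(x),y]+[x,d(y)]$ for all $x,y\in L$. The matrix of $d$ with respect to the ordered basis $(e_1,\dots,e_n,f_1,\dots,f_n,z)$ has as columns the coordinates of the images of the basis vectors, e.g. $d(e_i)=\sum_j A_{ji}e_j+\sum_k B_{ki}f_k+\mu_i z$. *)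

theory Defs
  imports "Jordan_Normal_Form.VS_Connect"
begin

text \<open>The underlying space of the Kronecker Leibniz algebra is the space of coordinate vectors of
  length \<open>2 * n + 1\<close>, with the ordered basis \<open>e\<^sub>1, \<dots>, e\<^sub>n, f\<^sub>1, \<dots>, f\<^sub>n, z\<close> being the standard
  basis. Vector and matrix positions count from 0, the indices \<open>i\<close> below count from 1.\<close>

abbreviation kron_space :: "nat \<Rightarrow> ('a::field, 'a vec) module" where
  "kron_space n \<equiv> module_vec TYPE('a) (2 * n + 1)"

definition kron_e :: "nat \<Rightarrow> nat \<Rightarrow> 'a::field vec" where
  "kron_e n i = unit_vec (2 * n + 1) (i - 1)"

definition kron_f :: "nat \<Rightarrow> nat \<Rightarrow> 'a::field vec" where
  "kron_f n i = unit_vec (2 * n + 1) (n + i - 1)"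

definition kron_z :: "nat \<Rightarrow> 'a::field vec" where
  "kron_z n = unit_vec (2 * n + 1) (2 * n)"

definition e_coord :: "nat \<Rightarrow> 'a::field vec \<Rightarrow> nat \<Rightarrow> 'a" where
  "e_coord n x i = x $ (i - 1)"

definition f_coord :: "nat \<Rightarrow> 'a::field vec \<Rightarrow> nat \<Rightarrow> 'a" where
  "f_coord n x i = x $ (n + i - 1)"

text \<open>The bilinear extension of \<open>[e\<^sub>i, f\<^sub>i] = [f\<^sub>i, e\<^sub>i] = z\<close> for \<open>1 \<le> i \<le> n\<close> and
  \<open>[e\<^sub>i, f\<^sub>i\<^sub>-\<^sub>1] = z\<close>, \<open>[f\<^sub>i\<^sub>-\<^sub>1, e\<^sub>i] = - z\<close> for \<open>2 \<le> i \<le> n\<close>, all other brackets of basis vectors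
  being zero; see the lemmas that follow.\<close>

definition kron_bracket :: "nat \<Rightarrow> 'a::field vec \<Rightarrow> 'a vec \<Rightarrow> 'a vec" where
  "kron_bracket n x y =
     ((\<Sum>i = 1..n. e_coord n x i * f_coord n y i + f_coord n x i * e_coord n y i)
      + (\<Sum>i = 2..n. e_coord n x i * f_coord n y (i - 1) - f_coord n x (i - 1) * e_coord n y i))
     \<cdot>\<^sub>v kron_z n"

lemma kron_bracket_closed: "kron_bracket n x y \<in> carrier_vec (2 * n + 1)"
  by (simp add: kron_bracket_def kron_z_def)

lemma kron_bracket_linear_left:
  assumes "x \<in> carrier_vec (2 * n + 1)" "x' \<in> carrier_vec (2 * n + 1)"
  shows "kron_bracket n (a \<cdot>\<^sub>v x + x') y = a \<cdot>\<^sub>v kron_bracket n x y + kron_bracket n x' y"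
proof -
  have e: "e_coord n (a \<cdot>\<^sub>v x + x') i = a * e_coord n x i + e_coord n x' i"
    if "i \<in> {1..n}" for i using that assms by (auto simp: e_coord_def)
  have f: "f_coord n (a \<cdot>\<^sub>v x + x') i = a * f_coord n x i + f_coord n x' i"
    if "i \<in> {1..n}" for i using that assms by (auto simp: f_coord_def)
  have f': "f_coord n (a \<cdot>\<^sub>v x + x') (i - Suc 0) = a * f_coord n x (i - Suc 0) + f_coord n x' (i - Suc 0)"
    if "i \<in> {2..n}" for i by (rule f) (use that in \<open>simp; arith\<close>)
  have 1: "(\<Sum>i = 1..n. e_coord n (a \<cdot>\<^sub>v x + x') i * f_coord n y i
        + f_coord n (a \<cdot>\<^sub>v x + x') i * e_coord n y i)
    = a * (\<Sum>i = 1..n. e_coord n x i * f_coord n y i + f_coord n x i * e_coord n y i)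
      + (\<Sum>i = 1..n. e_coord n x' i * f_coord n y i + f_coord n x' i * e_coord n y i)"
    unfolding sum_distrib_left sum.distrib[symmetric]
    by (rule sum.cong) (auto simp: e f f' algebra_simps)
  have 2: "(\<Sum>i = 2..n. e_coord n (a \<cdot>\<^sub>v x + x') i * f_coord n y (i - 1)
        - f_coord n (a \<cdot>\<^sub>v x + x') (i - 1) * e_coord n y i)
    = a * (\<Sum>i = 2..n. e_coord n x i * f_coord n y (i - 1) - f_coord n x (i - 1) * e_coord n y i)
      + (\<Sum>i = 2..n. e_coord n x' i * f_coord n y (i - 1) - f_coord n x' (i - 1) * e_coord n y i)"
    unfolding sum_distrib_left sum.distrib[symmetric]
    by (rule sum.cong) (auto simp: e f f' algebra_simps)
  show ?thesis unfolding kron_bracket_def 1 2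
    by (rule eq_vecI) (auto simp: kron_z_def algebra_simps)
qed

lemma kron_bracket_linear_right:
  assumes "y \<in> carrier_vec (2 * n + 1)" "y' \<in> carrier_vec (2 * n + 1)"
  shows "kron_bracket n x (a \<cdot>\<^sub>v y + y') = a \<cdot>\<^sub>v kron_bracket n x y + kron_bracket n x y'"
proof -
  have e: "e_coord n (a \<cdot>\<^sub>v y + y') i = a * e_coord n y i + e_coord n y' i"
    if "i \<in> {1..n}" for i using that assms by (auto simp: e_coord_def)
  have f: "f_coord n (a \<cdot>\<^sub>v y + y') i = a * f_coord n y i + f_coord n y' i"
    if "i \<in> {1..n}" for i using that assms by (auto simp: f_coord_def)
  have f': "f_coord n (a \<cdot>\<^sub>v y + y') (i - Suc 0) = a * f_coord n y (i - Suc 0) + f_coord n y' (i - Suc 0)"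
    if "i \<in> {2..n}" for i by (rule f) (use that in \<open>simp; arith\<close>)
  have 1: "(\<Sum>i = 1..n. e_coord n x i * f_coord n (a \<cdot>\<^sub>v y + y') i
        + f_coord n x i * e_coord n (a \<cdot>\<^sub>v y + y') i)
    = a * (\<Sum>i = 1..n. e_coord n x i * f_coord n y i + f_coord n x i * e_coord n y i)
      + (\<Sum>i = 1..n. e_coord n x i * f_coord n y' i + f_coord n x i * e_coord n y' i)"
    unfolding sum_distrib_left sum.distrib[symmetric]
    by (rule sum.cong) (auto simp: e f f' algebra_simps)
  have 2: "(\<Sum>i = 2..n. e_coord n x i * f_coord n (a \<cdot>\<^sub>v y + y') (i - 1)
        - f_coord n x (i - 1) * e_coord n (a \<cdot>\<^sub>v y + y') i)
    = a * (\<Sum>i = 2..n. e_coord n x i * f_coord n y (i - 1) - f_coord n x (i - 1) * e_coord n y i)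
      + (\<Sum>i = 2..n. e_coord n x i * f_coord n y' (i - 1) - f_coord n x (i - 1) * e_coord n y' i)"
    unfolding sum_distrib_left sum.distrib[symmetric]
    by (rule sum.cong) (auto simp: e f f' algebra_simps)
  show ?thesis unfolding kron_bracket_def 1 2
    by (rule eq_vecI) (auto simp: kron_z_def algebra_simps)
qed

lemma coord_basis:
  assumes "k \<in> {1..n}"
  shows "i \<in> {1..n} \<Longrightarrow> e_coord n (kron_e n i) k = (if k = i then 1 else 0)"
    and "i \<in> {1..n} \<Longrightarrow> f_coord n (kron_e n i) k = 0"
    and "i \<in> {1..n} \<Longrightarrow> e_coord n (kron_f n i) k = 0"
    and "i \<in> {1..n} \<Longrightarrow> f_coord n (kron_f n i) k = (if k = i then 1 else 0)"
    and "e_coord n (kron_z n) k = 0"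
    and "f_coord n (kron_z n) k = 0"
  using assms by (auto simp: e_coord_def f_coord_def kron_e_def kron_f_def kron_z_def)

lemma coord_basis_pred:
  assumes "k \<in> {2..n}"
  shows "i \<in> {1..n} \<Longrightarrow> f_coord n (kron_e n i) (k - Suc 0) = 0"
    and "i \<in> {1..n} \<Longrightarrow> f_coord n (kron_f n i) (k - Suc 0) = (if k = Suc i then 1 else 0)"
    and "f_coord n (kron_z n) (k - Suc 0) = 0"
proof -
  have k: "k - Suc 0 \<in> {1..n}" using assms by (simp; arith)
  show "i \<in> {1..n} \<Longrightarrow> f_coord n (kron_e n i) (k - Suc 0) = 0"
    by (rule coord_basis(2)[OF k])
  show "i \<in> {1..n} \<Longrightarrow> f_coord n (kron_f n i) (k - Suc 0) = (if k = Suc i then 1 else 0)"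
    using assms by (auto simp: coord_basis(4)[OF k])
  show "f_coord n (kron_z n) (k - Suc 0) = 0"
    by (rule coord_basis(6)[OF k])
qed

lemma kron_bracket_e_f:
  assumes "i \<in> {1..n}" "j \<in> {1..n}"
  shows "kron_bracket n (kron_e n i) (kron_f n j) =
           (if i = j \<or> i = j + 1 then kron_z n else 0\<^sub>v (2 * n + 1) :: 'a::field vec)"
proof -
  have 1: "(\<Sum>k = 1..n. e_coord n (kron_e n i) k * f_coord n (kron_f n j) k
      + f_coord n (kron_e n i) k * e_coord n (kron_f n j) k) = (if i = j then 1 else 0 :: 'a)"
  proof -
    have "(\<Sum>k = 1..n. e_coord n (kron_e n i) k * f_coord n (kron_f n j) k
      + f_coord n (kron_e n i) k * e_coord n (kron_f n j) k)
      = (\<Sum>k = 1..n. if k = i then if i = j then 1 else 0 else 0 :: 'a)"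
      using assms by (intro sum.cong) (auto simp: coord_basis coord_basis_pred)
    then show ?thesis using assms by (simp add: sum.delta)
  qed
  have 2: "(\<Sum>k = 2..n. e_coord n (kron_e n i) k * f_coord n (kron_f n j) (k - 1)
      - f_coord n (kron_e n i) (k - 1) * e_coord n (kron_f n j) k)
      = (if i = j + 1 then 1 else 0 :: 'a)"
  proof -
    have "(\<Sum>k = 2..n. e_coord n (kron_e n i) k * f_coord n (kron_f n j) (k - 1)
      - f_coord n (kron_e n i) (k - 1) * e_coord n (kron_f n j) k)
      = (\<Sum>k = 2..n. if k = i then if i = j + 1 then 1 else 0 else 0 :: 'a)"
      using assms by (intro sum.cong) (auto simp: coord_basis coord_basis_pred)
    then show ?thesis using assms by (auto simp: sum.delta)
  qed
  show ?thesis unfolding kron_bracket_def 1 2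
    by (rule eq_vecI) (auto simp: kron_z_def)
qed

lemma kron_bracket_f_e:
  assumes "i \<in> {1..n}" "j \<in> {1..n}"
  shows "kron_bracket n (kron_f n j) (kron_e n i) =
           (if i = j then kron_z n else if i = j + 1 then - kron_z n
            else 0\<^sub>v (2 * n + 1) :: 'a::field vec)"
proof -
  have 1: "(\<Sum>k = 1..n. e_coord n (kron_f n j) k * f_coord n (kron_e n i) k
      + f_coord n (kron_f n j) k * e_coord n (kron_e n i) k) = (if i = j then 1 else 0 :: 'a)"
  proof -
    have "(\<Sum>k = 1..n. e_coord n (kron_f n j) k * f_coord n (kron_e n i) k
      + f_coord n (kron_f n j) k * e_coord n (kron_e n i) k)
      = (\<Sum>k = 1..n. if k = i then if i = j then 1 else 0 else 0 :: 'a)"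
      using assms by (intro sum.cong) (auto simp: coord_basis coord_basis_pred)
    then show ?thesis using assms by (simp add: sum.delta)
  qed
  have 2: "(\<Sum>k = 2..n. e_coord n (kron_f n j) k * f_coord n (kron_e n i) (k - 1)
      - f_coord n (kron_f n j) (k - 1) * e_coord n (kron_e n i) k)
      = (if i = j + 1 then - 1 else 0 :: 'a)"
  proof -
    have "(\<Sum>k = 2..n. e_coord n (kron_f n j) k * f_coord n (kron_e n i) (k - 1)
      - f_coord n (kron_f n j) (k - 1) * e_coord n (kron_e n i) k)
      = (\<Sum>k = 2..n. if k = i then if i = j + 1 then - 1 else 0 else 0 :: 'a)"
      using assms by (intro sum.cong) (auto simp: coord_basis coord_basis_pred)
    then show ?thesis using assms by (auto simp: sum.delta)
  qed
  show ?thesis unfolding kron_bracket_def 1 2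
    by (rule eq_vecI) (auto simp: kron_z_def)
qed

lemma kron_bracket_zero:
  assumes "i \<in> {1..n}" "j \<in> {1..n}"
  shows "kron_bracket n (kron_e n i) (kron_e n j) = (0\<^sub>v (2 * n + 1) :: 'a::field vec)"
    and "kron_bracket n (kron_f n i) (kron_f n j) = (0\<^sub>v (2 * n + 1) :: 'a::field vec)"
  using assms by (auto simp: kron_bracket_def coord_basis coord_basis_pred intro!: eq_vecI)
    (simp_all add: kron_z_def)

lemma kron_bracket_z:
  "kron_bracket n (kron_z n) x = (0\<^sub>v (2 * n + 1) :: 'a::field vec)"
  "kron_bracket n x (kron_z n) = (0\<^sub>v (2 * n + 1) :: 'a::field vec)"
  by (auto simp: kron_bracket_def coord_basis coord_basis_pred intro!: eq_vecI)
    (simp_all add: kron_z_def)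

definition derivation ::
    "('a::field, 'v) module \<Rightarrow> ('v \<Rightarrow> 'v \<Rightarrow> 'v) \<Rightarrow> ('v \<Rightarrow> 'v) \<Rightarrow> bool" where
  "derivation L br d \<longleftrightarrow>
     linear_map class_ring L L d \<and>
     (\<forall>x \<in> carrier L. \<forall>y \<in> carrier L. d (br x y) = br (d x) y \<oplus>\<^bsub>L\<^esub> br x (d y))"

text \<open>The columns are the images of the basis vectors, in their given order.\<close>

definition kron_matrix :: "nat \<Rightarrow> ('a::field vec \<Rightarrow> 'a vec) \<Rightarrow> 'a mat" where
  "kron_matrix n d = mat_of_cols (2 * n + 1)
     (map (\<lambda>i. d (kron_e n i)) [1..<n + 1] @ map (\<lambda>i. d (kron_f n i)) [1..<n + 1] @ [d (kron_z n)])"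

definition mat_from_one :: "nat \<Rightarrow> (nat \<Rightarrow> nat \<Rightarrow> 'a) \<Rightarrow> 'a mat" where
  "mat_from_one n m = mat n n (\<lambda>(i, j). m (i + 1) (j + 1))"

definition block_A :: "nat \<Rightarrow> (nat \<Rightarrow> 'a::field) \<Rightarrow> 'a mat" where
  "block_A n \<alpha> = mat_from_one n (\<lambda>i j. if i \<le> j then \<alpha> (j - i + 1) else 0)"

definition block_D :: "nat \<Rightarrow> (nat \<Rightarrow> 'a::field) \<Rightarrow> 'a \<Rightarrow> 'a mat" where
  "block_D n \<alpha> \<beta>\<^sub>1 = mat_from_one n (\<lambda>i j.
     if i = j then \<beta>\<^sub>1 else if i > j then - \<alpha> (i - j + 1) else 0)"

definition block_B :: "nat \<Rightarrow> (nat \<Rightarrow> 'a::field) \<Rightarrow> 'a mat" where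
  "block_B n b = mat_from_one n (\<lambda>i j.
     if odd (i + j) \<and> i + j \<ge> n + 1 then (- 1) ^ (i + 1) * b (i + j) else 0)"

definition block_C :: "nat \<Rightarrow> (nat \<Rightarrow> 'a::field) \<Rightarrow> 'a mat" where
  "block_C n c = mat_from_one n (\<lambda>i j.
     if odd (i + j) \<and> i + j \<le> n + 1 then (- 1) ^ (i + 1) * c (i + j) else 0)"

end

theory Submission
  imports Defs
begin

text \<open>
  Every bracket is a multiple of \<open>z\<close>, and \<open>z\<close> brackets to zero with everything. Write
  \<open>[x, y] = (s(x, y) + t(x, y)) z\<close> with \<open>s\<close> symmetric and \<open>t\<close> alternating; on basis vectors
  \<open>s(e\<^sub>i, f\<^sub>i) = 1\<close> and \<open>t(e\<^sub>i, f\<^sub>i\<^sub>-\<^sub>1) = 1\<close>. A derivation maps \<open>z = [e\<^sub>1, f\<^sub>1]\<close> into the line of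
  brackets, so \<open>d z = \<gamma> z\<close>. When 2 is invertible, comparing the Leibniz rule at \<open>(x, y)\<close> and at
  \<open>(y, x)\<close> shows that a linear \<open>d\<close> with \<open>d z = \<gamma> z\<close> is a derivation iff it scales both forms
  infinitesimally:
  \<open>s(d x, y) + s(x, d y) = \<gamma> s(x, y)\<close>, and likewise for \<open>t\<close>. The coordinate of \<open>d x\<close> along \<open>z\<close> is
  invisible to the forms, whence the free row \<open>(\<mu>, \<nu>)\<close>.

  On basis vectors these conditions separate into three independent systems for the blocks
  (\<open>derivation_iff_block_equations\<close>). The pairs \<open>(e\<^sub>i, f\<^sub>j)\<close> involve only \<open>A\<close> and \<open>D\<close>: the form \<open>s\<close>
  says \<open>D = \<gamma> I - A\<^sup>T\<close>, and then \<open>t\<close> says that \<open>A\<close> is constant along diagonals, with zeros entering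
  at the left and bottom borders (\<open>toeplitz_pair_iff\<close>). The pairs \<open>(e\<^sub>i, e\<^sub>j)\<close> involve only \<open>B\<close>: \<open>s\<close>
  makes \<open>B\<close> antisymmetric, and \<open>t\<close> then makes the entries along an antidiagonal alternate in sign.
  An antidiagonal with \<open>i + j\<close> even meets the main diagonal, where an antisymmetric matrix vanishes,
  and an antidiagonal with \<open>i + j \<le> n\<close> ends at the left border in a zero; the remaining
  antidiagonals carry one free parameter each (\<open>lower_hankel_iff\<close>). The pairs \<open>(f\<^sub>i, f\<^sub>j)\<close> treat \<open>C\<close>
  in the same way, the zeros now entering from the right border (\<open>upper_hankel_iff\<close>).

  All borders are handled by continuing the coordinate functions by zero outside \<open>1, \<dots>, n\<close>.
\<close>

section \<open>Toeplitz and alternating Hankel matrices\<close>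

text \<open>
  The first equation expresses \<open>D\<close> through \<open>A\<close>; substituted into the second it gives
  \<open>A\<^sub>i\<^sub>+\<^sub>1\<^sub>,\<^sub>j\<^sub>+\<^sub>1 = A\<^sub>i\<^sub>j\<close>. The row 0 of \<open>D\<close> being zero forces the first column of \<open>A\<close> below the diagonal to
  vanish, and with it every subdiagonal. The row \<open>n + 1\<close> of \<open>A\<close> being zero asks for zeros in the
  last row of \<open>A\<close>, which lie on the same subdiagonals.
\<close>
lemma toeplitz_pair_iff:
  fixes A D :: "nat \<Rightarrow> nat \<Rightarrow> 'a::field"
  assumes n: "n \<ge> 1"
    and A_pad: "\<And>j. A (n + 1) j = 0" and D_pad: "\<And>j. D 0 j = 0"
  shows "(\<forall>i\<in>{1..n}. \<forall>j\<in>{1..n}. A j i + D i j = (if i = j then \<gamma> else 0) \<and>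
            A (j + 1) i + D (i - 1) j = (if i = j + 1 then \<gamma> else 0)) \<longleftrightarrow>
         (\<exists>\<alpha> \<beta>. \<gamma> = \<alpha> 1 + \<beta> \<and> (\<forall>i\<in>{1..n}. \<forall>j\<in>{1..n}.
            A i j = (if i \<le> j then \<alpha> (j - i + 1) else 0) \<and>
            D i j = (if i = j then \<beta> else if i > j then - \<alpha> (i - j + 1) else 0)))"
    (is "?L \<longleftrightarrow> ?R")
proof
  assume L: ?L
  have sym: "D i j = (if i = j then \<gamma> else 0) - A j i" if "i \<in> {1..n}" "j \<in> {1..n}" for i j
    using L[rule_format, of i j] that by (simp add: eq_diff_eq add.commute)
  have col1: "A (j + 1) 1 = 0" if "j \<in> {1..n}" for j
    using L[rule_format, of 1 j] that n D_pad by auto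
  have step: "A (i + 1) (j + 1) = A i j" if "i \<in> {1..n}" "1 \<le> j" "j < n" for i j
  proof -
    have "A (i + 1) (j + 1) + D j i = (if j = i then \<gamma> else 0)"
      using L[rule_format, of "j + 1" i] that by simp
    then show ?thesis using sym[of j i] that by (simp split: if_splits)
  qed
  have diag: "A (i + k) (j + k) = A i j" if "1 \<le> i" "1 \<le> j" "i + k \<le> n" "j + k \<le> n" for i j k
    using that
  proof (induction k)
    case (Suc k)
    then show ?case using step[of "i + k" "j + k"] by simp
  qed simp
  have A_form: "A i j = (if i \<le> j then A 1 (j - i + 1) else 0)"
    if "i \<in> {1..n}" "j \<in> {1..n}" for i j
  proof (cases "i \<le> j")
    case True
    then show ?thesis using diag[of 1 "j - i + 1" "i - 1"] that by auto
  next
    case False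
    then have "A (i - j + 1) 1 = 0" by (intro col1) (use that in auto)
    then show ?thesis using diag[of "i - j + 1" 1 "j - 1"] False that by auto
  qed
  have "A i j = (if i \<le> j then A 1 (j - i + 1) else 0) \<and>
      D i j = (if i = j then \<gamma> - A 1 1 else if i > j then - A 1 (i - j + 1) else 0)"
    if "i \<in> {1..n}" "j \<in> {1..n}" for i j
    using A_form[OF that] A_form[OF that(2,1)] sym[OF that] by auto
  then show ?R by (intro exI[of _ "A 1"] exI[of _ "\<gamma> - A 1 1"]) auto
next
  assume ?R
  then obtain \<alpha> \<beta> where g: "\<gamma> = \<alpha> 1 + \<beta>"
    and A: "\<And>i j. i \<in> {1..n} \<Longrightarrow> j \<in> {1..n} \<Longrightarrow> A i j = (if i \<le> j then \<alpha> (j - i + 1) else 0)"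
    and D: "\<And>i j. i \<in> {1..n} \<Longrightarrow> j \<in> {1..n} \<Longrightarrow>
      D i j = (if i = j then \<beta> else if i > j then - \<alpha> (i - j + 1) else 0)"
    by blast
  show ?L
  proof (intro ballI conjI)
    fix i j assume ij: "i \<in> {1..n}" "j \<in> {1..n}"
    show "A j i + D i j = (if i = j then \<gamma> else 0)"
      using ij by (auto simp: A D g)
    have A': "A (j + 1) i = (if j + 1 \<le> i then \<alpha> (i - j) else 0)"
      using ij A_pad A[of "j + 1" i] by (cases "j = n") (auto simp: Suc_diff_Suc)
    have D': "D (i - 1) j = (if i = j + 1 then \<beta> else if i > j + 1 then - \<alpha> (i - j) else 0)"
    proof (cases "i = 1")
      case True
      then show ?thesis using ij D_pad by simp
    next
      case False
      then have "i - 1 \<in> {1..n}" using ij by auto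
      from D[OF this ij(2)] show ?thesis using False ij by (auto simp: Suc_diff_Suc)
    qed
    show "A (j + 1) i + D (i - 1) j = (if i = j + 1 then \<gamma> else 0)"
      unfolding A' D' g by auto
  qed
qed

lemma antidiagonal_alternates:
  fixes M :: "nat \<Rightarrow> nat \<Rightarrow> 'a::field"
  assumes shift: "\<And>i j. \<lbrakk>1 \<le> i; i < n; 1 \<le> j; j < n\<rbrakk> \<Longrightarrow> M (i + 1) j = - M i (j + 1)"
    and "1 \<le> i" "1 \<le> j" "i + k \<le> n" "j + k \<le> n"
  shows "M (i + k) j = (- 1) ^ k * M i (j + k)"
  using assms(2-)
proof (induction k arbitrary: j)
  case (Suc k)
  have "M (i + Suc k) j = - M (i + k) (j + 1)"
    using shift[of "i + k" j] Suc.prems by simp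
  also have "M (i + k) (j + 1) = (- 1) ^ k * M i (j + 1 + k)"
    using Suc.IH[of "j + 1"] Suc.prems by simp
  finally show ?case by simp
qed simp

text \<open>
  Up to sign, all entries of such an antidiagonal agree with the one on the main diagonal, and
  \<open>2 M\<^sub>i\<^sub>i = 0\<close>.
\<close>
lemma skew_even_antidiagonal_zero:
  fixes M :: "nat \<Rightarrow> nat \<Rightarrow> 'a::field"
  assumes two: "(2::'a) \<noteq> 0"
    and shift: "\<And>i j. \<lbrakk>1 \<le> i; i < n; 1 \<le> j; j < n\<rbrakk> \<Longrightarrow> M (i + 1) j = - M i (j + 1)"
    and skew: "\<And>i j. \<lbrakk>i \<in> {1..n}; j \<in> {1..n}\<rbrakk> \<Longrightarrow> M i j + M j i = 0"
    and ij: "i \<in> {1..n}" "j \<in> {1..n}" "even (i + j)"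
  shows "M i j = 0"
proof -
  have upper: "M i j = 0" if "i \<in> {1..n}" "j \<in> {1..n}" "even (i + j)" "i \<le> j" for i j
  proof -
    define m where "m = (j - i) div 2"
    have m: "j = i + 2 * m" using that unfolding m_def by auto
    have "2 * M (i + m) (i + m) = 0"
      using skew[of "i + m" "i + m"] that m by simp
    then have "M (i + m) (i + m) = 0" using two by simp
    moreover have "M (i + m) (i + m) = (- 1) ^ m * M i (i + m + m)"
      by (rule antidiagonal_alternates[where n = n]) (use shift that m in auto)
    ultimately show ?thesis using m by (simp add: mult_2 add.assoc)
  qed
  show ?thesis
  proof (cases "i \<le> j")
    case False
    then have "M j i = 0" using upper[of j i] ij by (simp add: add.commute)
    then show ?thesis using skew[of i j] ij by simp
  qed (use upper ij in blast)
qed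

text \<open>
  Antisymmetry turns \<open>M\<^sub>i\<^sub>,\<^sub>j\<^sub>+\<^sub>1 = M\<^sub>j\<^sub>,\<^sub>i\<^sub>+\<^sub>1\<close> into alternation along antidiagonals. The row 0 being zero
  forces \<open>M\<^sub>k\<^sub>1 = 0\<close> for \<open>k < n\<close>, which kills the antidiagonals that reach the first column above its
  last entry; each of the others contains a unique entry of row \<open>n\<close>, which parametrises it.
\<close>
lemma lower_hankel_iff:
  fixes M :: "nat \<Rightarrow> nat \<Rightarrow> 'a::field"
  assumes two: "(2::'a) \<noteq> 0" and pad: "\<And>j. M 0 j = 0"
  shows "(\<forall>i\<in>{1..n}. \<forall>j\<in>{1..n}. M i j + M j i = 0 \<and> M (i - 1) j = M (j - 1) i) \<longleftrightarrow>
         (\<exists>b. \<forall>i\<in>{1..n}. \<forall>j\<in>{1..n}.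
            M i j = (if odd (i + j) \<and> i + j \<ge> n + 1 then (- 1) ^ (i + 1) * b (i + j) else 0))"
    (is "?L \<longleftrightarrow> ?R")
proof
  assume L: ?L
  have skew: "M i j + M j i = 0" if "i \<in> {1..n}" "j \<in> {1..n}" for i j
    using L that by blast
  have shift: "M (i + 1) j = - M i (j + 1)" if "1 \<le> i" "i < n" "1 \<le> j" "j < n" for i j
    using L[rule_format, of "i + 1" "j + 1"] skew[of "i + 1" j] that
    by (simp add: eq_neg_iff_add_eq_0)
  have alternates: "M (i + k) j = (- 1) ^ k * M i (j + k)"
    if "1 \<le> i" "1 \<le> j" "i + k \<le> n" "j + k \<le> n" for i j k
    by (rule antidiagonal_alternates[where n = n]) (use shift that in blast)+
  have even_zero: "M i j = 0" if "i \<in> {1..n}" "j \<in> {1..n}" "even (i + j)" for i j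
    by (rule skew_even_antidiagonal_zero[where n = n]) (use two shift skew that in blast)+
  have col1: "M k 1 = 0" if "1 \<le> k" "k < n" for k
    using L[rule_format, of "k + 1" 1] that pad by simp
  \<comment> \<open>The sign makes the formula an identity on row \<open>n\<close>.\<close>
  define b where "b s = (- 1) ^ (n + 1) * M n (s - n)" for s
  have "M i j = (if odd (i + j) \<and> i + j \<ge> n + 1 then (- 1) ^ (i + 1) * b (i + j) else 0)"
    if ij: "i \<in> {1..n}" "j \<in> {1..n}" for i j
  proof -
    consider "even (i + j)" | "odd (i + j)" "i + j \<le> n" | "odd (i + j)" "i + j \<ge> n + 1"
      by linarith
    then show ?thesis
    proof cases
      case 1
      then show ?thesis using even_zero[OF ij] by simp
    next
      case 2
      then show ?thesis using alternates[of i 1 "j - 1"] col1[of "i + (j - 1)"] ij by auto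
    next
      case 3
      then have "M n (i + j - n) = (- 1) ^ (n - i) * M i j"
        using alternates[of i "i + j - n" "n - i"] ij by auto
      then have "M i j = (- 1) ^ (n - i) * M n (i + j - n)" by (simp add: minus_one_power_iff)
      also have "\<dots> = (- 1) ^ (i + 1) * b (i + j)"
        using ij unfolding b_def by (auto simp: minus_one_power_iff)
      finally show ?thesis using 3 by simp
    qed
  qed
  then show ?R by blast
next
  assume ?R
  then obtain b where M: "\<And>i j. \<lbrakk>i \<in> {1..n}; j \<in> {1..n}\<rbrakk> \<Longrightarrow>
      M i j = (if odd (i + j) \<and> i + j \<ge> n + 1 then (- 1) ^ (i + 1) * b (i + j) else 0)"
    by blast
  show ?L
  proof (intro ballI conjI)
    fix i j assume ij: "i \<in> {1..n}" "j \<in> {1..n}"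
    show "M i j + M j i = 0"
      using ij by (auto simp: M add.commute minus_one_power_iff)
    have M': "M (i - 1) j = (if even (i + j) \<and> i + j \<ge> n + 2 then (- 1) ^ i * b (i + j - 1) else 0)"
      if ij: "i \<in> {1..n}" "j \<in> {1..n}" for i j
    proof (cases "i = 1")
      case True
      then show ?thesis using ij pad by auto
    next
      case False
      then obtain k where "i = k + 1" "k \<in> {1..n}" using ij by (cases i) auto
      then show ?thesis using M[of k j] ij(2) by auto
    qed
    show "M (i - 1) j = M (j - 1) i"
      unfolding M'[OF ij] M'[OF ij(2,1)] by (auto simp: add.commute minus_one_power_iff)
  qed
qed

text \<open>
  The mirror image of \<open>lower_hankel_iff\<close> under \<open>i \<mapsto> n + 1 - i\<close>, up to signs of the parameters: the row \<open>n + 1\<close> being zero forces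
  the last column to vanish below its first entry, and the antidiagonals with \<open>i + j \<le> n + 1\<close> are
  parametrised by their entry in row 1.
\<close>
lemma upper_hankel_iff:
  fixes M :: "nat \<Rightarrow> nat \<Rightarrow> 'a::field"
  assumes two: "(2::'a) \<noteq> 0" and pad: "\<And>j. M (n + 1) j = 0"
  shows "(\<forall>i\<in>{1..n}. \<forall>j\<in>{1..n}. M i j + M j i = 0 \<and> M (j + 1) i = M (i + 1) j) \<longleftrightarrow>
         (\<exists>c. \<forall>i\<in>{1..n}. \<forall>j\<in>{1..n}.
            M i j = (if odd (i + j) \<and> i + j \<le> n + 1 then (- 1) ^ (i + 1) * c (i + j) else 0))"
    (is "?L \<longleftrightarrow> ?R")
proof
  assume L: ?L
  have skew: "M i j + M j i = 0" if "i \<in> {1..n}" "j \<in> {1..n}" for i j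
    using L that by blast
  have shift: "M (i + 1) j = - M i (j + 1)" if "1 \<le> i" "i < n" "1 \<le> j" "j < n" for i j
    using L[rule_format, of i j] skew[of i "j + 1"] that
    by (simp add: eq_neg_iff_add_eq_0 add.commute)
  have alternates: "M (i + k) j = (- 1) ^ k * M i (j + k)"
    if "1 \<le> i" "1 \<le> j" "i + k \<le> n" "j + k \<le> n" for i j k
    by (rule antidiagonal_alternates[where n = n]) (use shift that in blast)+
  have even_zero: "M i j = 0" if "i \<in> {1..n}" "j \<in> {1..n}" "even (i + j)" for i j
    by (rule skew_even_antidiagonal_zero[where n = n]) (use two shift skew that in blast)+
  have coln: "M (k + 1) n = 0" if "1 \<le> k" "k < n" for k
    using L[rule_format, of n k] that pad by simp
  define c where "c s = M 1 (s - 1)" for s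
  have "M i j = (if odd (i + j) \<and> i + j \<le> n + 1 then (- 1) ^ (i + 1) * c (i + j) else 0)"
    if ij: "i \<in> {1..n}" "j \<in> {1..n}" for i j
  proof -
    consider "even (i + j)" | "odd (i + j)" "i + j \<ge> n + 2" | "odd (i + j)" "i + j \<le> n + 1"
      by linarith
    then show ?thesis
    proof cases
      case 1
      then show ?thesis using even_zero[OF ij] by simp
    next
      case 2
      then obtain k where "i + j = n + (k + 1)" "1 \<le> k"
        by (intro that[of "i + j - n - 1"]) auto
      then have "M (i + j - n) n = 0" using coln[of k] ij by auto
      moreover have "M i j = (- 1) ^ (n - j) * M (i + j - n) n"
        using alternates[of "i + j - n" j "n - j"] ij 2 by auto
      ultimately show ?thesis using 2 by simp
    next
      case 3
      then have "M i j = (- 1) ^ (i - 1) * M 1 (i + j - 1)"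
        using alternates[of 1 j "i - 1"] ij by (auto simp: add.commute)
      also have "\<dots> = (- 1) ^ (i + 1) * c (i + j)"
        using ij unfolding c_def by (auto simp: minus_one_power_iff)
      finally show ?thesis using 3 by simp
    qed
  qed
  then show ?R by blast
next
  assume ?R
  then obtain c where M: "\<And>i j. \<lbrakk>i \<in> {1..n}; j \<in> {1..n}\<rbrakk> \<Longrightarrow>
      M i j = (if odd (i + j) \<and> i + j \<le> n + 1 then (- 1) ^ (i + 1) * c (i + j) else 0)"
    by blast
  show ?L
  proof (intro ballI conjI)
    fix i j assume ij: "i \<in> {1..n}" "j \<in> {1..n}"
    show "M i j + M j i = 0"
      using ij by (auto simp: M add.commute minus_one_power_iff)
    have M': "M (i + 1) j = (if even (i + j) \<and> i + j \<le> n then (- 1) ^ i * c (i + j + 1) else 0)"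
      if ij: "i \<in> {1..n}" "j \<in> {1..n}" for i j
    proof (cases "i = n")
      case True
      then show ?thesis using ij pad by auto
    next
      case False
      then have "i + 1 \<in> {1..n}" using ij by auto
      from M[OF this ij(2)] show ?thesis using False ij by auto
    qed
    show "M (j + 1) i = M (i + 1) j"
      unfolding M'[OF ij] M'[OF ij(2,1)] by (auto simp: add.commute minus_one_power_iff)
  qed
qed

section \<open>Brackets with basis vectors\<close>

text \<open>
  Continuing coordinates by zero lets the formulas for brackets with \<open>e\<^sub>1\<close> and \<open>f\<^sub>n\<close>, where one of
  the two summands is absent, be written like all the others.
\<close>
definition pad :: "nat \<Rightarrow> (nat \<Rightarrow> 'a::zero) \<Rightarrow> nat \<Rightarrow> 'a" where
  "pad n g i = (if i \<in> {1..n} then g i else 0)"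

lemma bracket_with_basis:
  fixes x y :: "'a::field vec"
  assumes "i \<in> {1..n}"
  shows "kron_bracket n (kron_e n i) y =
           (pad n (f_coord n y) i + pad n (f_coord n y) (i - 1)) \<cdot>\<^sub>v kron_z n"
    and "kron_bracket n x (kron_e n i) =
           (pad n (f_coord n x) i - pad n (f_coord n x) (i - 1)) \<cdot>\<^sub>v kron_z n"
    and "kron_bracket n x (kron_f n i) =
           (pad n (e_coord n x) i + pad n (e_coord n x) (i + 1)) \<cdot>\<^sub>v kron_z n"
    and "kron_bracket n (kron_f n i) y =
           (pad n (e_coord n y) i - pad n (e_coord n y) (i + 1)) \<cdot>\<^sub>v kron_z n"
proof -
  have pad_pred: "pad n g (i - 1) = (if i \<in> {2..n} then g (i - 1) else 0)" for g :: "nat \<Rightarrow> 'a"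
    using assms by (auto simp: pad_def)
  have delta1: "(\<Sum>k = 1..n. if k = i then g k else 0) = pad n g i" for g :: "nat \<Rightarrow> 'a"
    using assms by (simp add: pad_def)
  have delta2: "(\<Sum>k = 2..n. if k = i then g (k - 1) else 0) = pad n g (i - 1)" for g :: "nat \<Rightarrow> 'a"
    unfolding pad_pred by simp
  have delta3: "(\<Sum>k = 2..n. if k = i + 1 then g k else 0) = pad n g (i + 1)" for g :: "nat \<Rightarrow> 'a"
    using assms by (simp add: pad_def)
  have "(\<Sum>k = 1..n. e_coord n (kron_e n i) k * f_coord n y k + f_coord n (kron_e n i) k * e_coord n y k)
      = (\<Sum>k = 1..n. if k = i then f_coord n y k else 0)"
    "(\<Sum>k = 2..n. e_coord n (kron_e n i) k * f_coord n y (k - 1)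
        - f_coord n (kron_e n i) (k - 1) * e_coord n y k)
      = (\<Sum>k = 2..n. if k = i then f_coord n y (k - 1) else 0)"
    by (intro sum.cong refl; use assms in \<open>auto simp: coord_basis coord_basis_pred\<close>)+
  then show "kron_bracket n (kron_e n i) y =
      (pad n (f_coord n y) i + pad n (f_coord n y) (i - 1)) \<cdot>\<^sub>v kron_z n"
    unfolding kron_bracket_def delta1 delta2 by simp
  have "(\<Sum>k = 1..n. e_coord n x k * f_coord n (kron_e n i) k + f_coord n x k * e_coord n (kron_e n i) k)
      = (\<Sum>k = 1..n. if k = i then f_coord n x k else 0)"
    "(\<Sum>k = 2..n. e_coord n x k * f_coord n (kron_e n i) (k - 1)
        - f_coord n x (k - 1) * e_coord n (kron_e n i) k)
      = - (\<Sum>k = 2..n. if k = i then f_coord n x (k - 1) else 0)"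
    unfolding sum_negf[symmetric]
    by (intro sum.cong refl; use assms in \<open>auto simp: coord_basis coord_basis_pred\<close>)+
  then show "kron_bracket n x (kron_e n i) =
      (pad n (f_coord n x) i - pad n (f_coord n x) (i - 1)) \<cdot>\<^sub>v kron_z n"
    unfolding kron_bracket_def delta1 delta2 by simp
  have "(\<Sum>k = 1..n. e_coord n x k * f_coord n (kron_f n i) k + f_coord n x k * e_coord n (kron_f n i) k)
      = (\<Sum>k = 1..n. if k = i then e_coord n x k else 0)"
    "(\<Sum>k = 2..n. e_coord n x k * f_coord n (kron_f n i) (k - 1)
        - f_coord n x (k - 1) * e_coord n (kron_f n i) k)
      = (\<Sum>k = 2..n. if k = i + 1 then e_coord n x k else 0)"
    by (intro sum.cong refl; use assms in \<open>auto simp: coord_basis coord_basis_pred\<close>)+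
  then show "kron_bracket n x (kron_f n i) =
      (pad n (e_coord n x) i + pad n (e_coord n x) (i + 1)) \<cdot>\<^sub>v kron_z n"
    unfolding kron_bracket_def delta1 delta3 by simp
  have "(\<Sum>k = 1..n. e_coord n (kron_f n i) k * f_coord n y k + f_coord n (kron_f n i) k * e_coord n y k)
      = (\<Sum>k = 1..n. if k = i then e_coord n y k else 0)"
    "(\<Sum>k = 2..n. e_coord n (kron_f n i) k * f_coord n y (k - 1)
        - f_coord n (kron_f n i) (k - 1) * e_coord n y k)
      = - (\<Sum>k = 2..n. if k = i + 1 then e_coord n y k else 0)"
    unfolding sum_negf[symmetric]
    by (intro sum.cong refl; use assms in \<open>auto simp: coord_basis coord_basis_pred\<close>)+
  then show "kron_bracket n (kron_f n i) y =
      (pad n (e_coord n y) i - pad n (e_coord n y) (i + 1)) \<cdot>\<^sub>v kron_z n"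
    unfolding kron_bracket_def delta1 delta3 by simp
qed

lemma kron_basis_closed:
  "kron_e n i \<in> carrier_vec (2 * n + 1)"
  "kron_f n i \<in> carrier_vec (2 * n + 1)"
  "kron_z n \<in> carrier_vec (2 * n + 1)"
  by (simp_all add: kron_e_def kron_f_def kron_z_def)

section \<open>Reduction of the Leibniz rule to basis vectors\<close>

lemma unit_vec_combination_induct [consumes 1, case_names zero add]:
  fixes x :: "'a::comm_ring_1 vec"
  assumes x: "x \<in> carrier_vec m"
    and zero: "P (0\<^sub>v m)"
    and add: "\<And>a k y. \<lbrakk>k < m; y \<in> carrier_vec m; P y\<rbrakk> \<Longrightarrow> P (a \<cdot>\<^sub>v unit_vec m k + y)"
  shows "P x"
proof -
  have "P x" if "x \<in> carrier_vec m" "r \<le> m" "\<And>k. \<lbrakk>r \<le> k; k < m\<rbrakk> \<Longrightarrow> x $ k = 0" for r x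
    using that
  proof (induction r arbitrary: x)
    case 0
    then have "x = 0\<^sub>v m" by (intro eq_vecI) auto
    then show ?case using zero by simp
  next
    case (Suc r)
    define y where "y = vec m (\<lambda>k. if k = r then 0 else x $ k)"
    have "P y" by (rule Suc.IH) (use Suc.prems in \<open>auto simp: y_def\<close>)
    then have "P (x $ r \<cdot>\<^sub>v unit_vec m r + y)"
      using Suc.prems by (intro add) (auto simp: y_def)
    also have "x $ r \<cdot>\<^sub>v unit_vec m r + y = x"
      using Suc.prems by (intro eq_vecI) (auto simp: y_def)
    finally show ?case .
  qed
  from this[of x m] show ?thesis using x by simp
qed

lemma kron_basis_cases:
  assumes "k < 2 * n + 1"
  obtains (e) i where "i \<in> {1..n}" "unit_vec (2 * n + 1) k = (kron_e n i :: 'a::field vec)"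
    | (f) i where "i \<in> {1..n}" "unit_vec (2 * n + 1) k = (kron_f n i :: 'a vec)"
    | (z) "unit_vec (2 * n + 1) k = (kron_z n :: 'a vec)"
proof -
  consider "k < n" | "n \<le> k" "k < 2 * n" | "k = 2 * n" using assms by linarith
  then show ?thesis
  proof cases
    case 1 then show ?thesis by (intro e[of "k + 1"]) (auto simp: kron_e_def)
  next
    case 2 then show ?thesis by (intro f[of "k - n + 1"]) (auto simp: kron_f_def)
  next
    case 3 then show ?thesis by (intro z) (auto simp: kron_z_def)
  qed
qed

text \<open>
  The zero vector is covered by \<open>add\<close>, as the combination \<open>(-1) z + z\<close>.
\<close>
lemma kron_span_induct [consumes 1, case_names add e f z]:
  fixes x :: "'a::field vec"
  assumes "x \<in> carrier_vec (2 * n + 1)"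
    and add: "\<And>a y y'. \<lbrakk>y \<in> carrier_vec (2 * n + 1); y' \<in> carrier_vec (2 * n + 1); P y; P y'\<rbrakk>
               \<Longrightarrow> P (a \<cdot>\<^sub>v y + y')"
    and e: "\<And>i. i \<in> {1..n} \<Longrightarrow> P (kron_e n i)"
    and f: "\<And>i. i \<in> {1..n} \<Longrightarrow> P (kron_f n i)"
    and z: "P (kron_z n)"
  shows "P x"
  using assms(1)
proof (induction rule: unit_vec_combination_induct)
  case zero
  have "(- 1) \<cdot>\<^sub>v kron_z n + kron_z n = (0\<^sub>v (2 * n + 1) :: 'a vec)"
    by (rule eq_vecI) (auto simp: kron_z_def)
  then show ?case
    using add[OF kron_basis_closed(3) kron_basis_closed(3) z z, of "- 1"] by (simp only:)
next
  case (add a k y)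
  have "P (unit_vec (2 * n + 1) k)"
    using add(1) by (cases rule: kron_basis_cases[where 'a = 'a]) (auto intro: e f z)
  then show ?case using add by (intro assms(2)) auto
qed

lemma kron_linear_map_simps:
  assumes "linear_map class_ring (kron_space n) (kron_space n) d"
  shows "x \<in> carrier_vec (2 * n + 1) \<Longrightarrow> d x \<in> carrier_vec (2 * n + 1)"
    and "\<lbrakk>x \<in> carrier_vec (2 * n + 1); y \<in> carrier_vec (2 * n + 1)\<rbrakk>
           \<Longrightarrow> d (a \<cdot>\<^sub>v x + y) = a \<cdot>\<^sub>v d x + d y"
    and "x \<in> carrier_vec (2 * n + 1) \<Longrightarrow> d (a \<cdot>\<^sub>v x) = a \<cdot>\<^sub>v d x"
    and "d (0\<^sub>v (2 * n + 1)) = 0\<^sub>v (2 * n + 1)"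
proof -
  interpret linear_map class_ring "kron_space n" "kron_space n" d by (rule assms)
  show closed: "x \<in> carrier_vec (2 * n + 1) \<Longrightarrow> d x \<in> carrier_vec (2 * n + 1)" for x
    using T_im by (simp add: module_vec_simps)
  show smult: "x \<in> carrier_vec (2 * n + 1) \<Longrightarrow> d (a \<cdot>\<^sub>v x) = a \<cdot>\<^sub>v d x" for x a
    using T_smult[of a x] by (simp add: module_vec_simps class_ring_simps)
  show "\<lbrakk>x \<in> carrier_vec (2 * n + 1); y \<in> carrier_vec (2 * n + 1)\<rbrakk>
      \<Longrightarrow> d (a \<cdot>\<^sub>v x + y) = a \<cdot>\<^sub>v d x + d y"
    using T_add[of "a \<cdot>\<^sub>v x" y] smult[of x a] by (simp add: module_vec_simps)
  show "d (0\<^sub>v (2 * n + 1)) = 0\<^sub>v (2 * n + 1)"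
    using T0_is_0 by (simp add: module_vec_simps)
qed

definition leibniz_at :: "nat \<Rightarrow> ('a::field vec \<Rightarrow> 'a vec) \<Rightarrow> 'a vec \<Rightarrow> 'a vec \<Rightarrow> bool" where
  "leibniz_at n d x y \<longleftrightarrow> d (kron_bracket n x y) = kron_bracket n (d x) y + kron_bracket n x (d y)"

lemma leibniz_at_combination:
  fixes x x' y :: "'a::field vec"
  assumes d: "linear_map class_ring (kron_space n) (kron_space n) d"
    and x: "x \<in> carrier_vec (2 * n + 1)" and x': "x' \<in> carrier_vec (2 * n + 1)"
    and y: "y \<in> carrier_vec (2 * n + 1)"
  shows "leibniz_at n d x y \<Longrightarrow> leibniz_at n d x' y \<Longrightarrow> leibniz_at n d (a \<cdot>\<^sub>v x + x') y"
    and "leibniz_at n d y x \<Longrightarrow> leibniz_at n d y x' \<Longrightarrow> leibniz_at n d y (a \<cdot>\<^sub>v x + x')"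
proof -
  have dim [simp]: "dim_vec (kron_bracket n u v) = Suc (2 * n)" for u v :: "'a vec"
    using kron_bracket_closed[of n u v] by simp
  note linear = kron_linear_map_simps(2)[OF d] kron_bracket_linear_left kron_bracket_linear_right
  note closed = kron_linear_map_simps(1)[OF d] kron_bracket_closed x x' y
  show "leibniz_at n d (a \<cdot>\<^sub>v x + x') y" if "leibniz_at n d x y" "leibniz_at n d x' y"
    using that unfolding leibniz_at_def
    by (simp only: linear closed) (auto intro!: eq_vecI simp: algebra_simps)
  show "leibniz_at n d y (a \<cdot>\<^sub>v x + x')" if "leibniz_at n d y x" "leibniz_at n d y x'"
    using that unfolding leibniz_at_def
    by (simp only: linear closed) (auto intro!: eq_vecI simp: algebra_simps)
qed

text \<open>
  Both sides of the Leibniz rule are bilinear, so it propagates from basis vectors to all vectors,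
  first in the right argument and then in the left one.
\<close>
lemma derivation_iff_leibniz_on_basis:
  fixes d :: "'a::field vec \<Rightarrow> 'a vec"
  assumes d: "linear_map class_ring (kron_space n) (kron_space n) d"
  defines "basis \<equiv> kron_e n ` {1..n} \<union> kron_f n ` {1..n} \<union> {kron_z n}"
  shows "derivation (kron_space n) (kron_bracket n) d \<longleftrightarrow>
    (\<forall>x\<in>basis. \<forall>y\<in>basis. leibniz_at n d x y)"
proof -
  have basis: "basis \<subseteq> carrier_vec (2 * n + 1)" 
    unfolding basis_def using kron_basis_closed by blast
  have "leibniz_at n d x y"
    if L: "\<forall>x\<in>basis. \<forall>y\<in>basis. leibniz_at n d x y"
      and xy: "x \<in> carrier_vec (2 * n + 1)" "y \<in> carrier_vec (2 * n + 1)" for x y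
  proof -
    have right: "leibniz_at n d x y" if "x \<in> basis" for x
      using xy(2)
    proof (induction rule: kron_span_induct)
      case (add a y y')
      then show ?case using leibniz_at_combination(2)[OF d] basis that by blast
    qed (use L that in \<open>auto simp: basis_def\<close>)
    show ?thesis
      using xy(1)
    proof (induction rule: kron_span_induct)
      case (add a x x')
      then show ?case using leibniz_at_combination(1)[OF d] xy(2) by blast
    qed (auto intro!: right simp: basis_def)
  qed
  moreover have "derivation (kron_space n) (kron_bracket n) d \<longleftrightarrow>
      (\<forall>x\<in>carrier_vec (2 * n + 1). \<forall>y\<in>carrier_vec (2 * n + 1). leibniz_at n d x y)"
    using d unfolding derivation_def leibniz_at_def by (simp add: module_vec_simps)
  ultimately show ?thesis using basis by blast
qed

section \<open>The Leibniz rule as equations between block entries\<close>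

lemma kron_z_smult_eq_iff: "a \<cdot>\<^sub>v kron_z n = b \<cdot>\<^sub>v kron_z n \<longleftrightarrow> (a::'a::field) = b"
proof
  assume "a \<cdot>\<^sub>v kron_z n = b \<cdot>\<^sub>v kron_z n"
  then have "(a \<cdot>\<^sub>v kron_z n) $ (2 * n) = (b \<cdot>\<^sub>v kron_z n) $ (2 * n)" by simp
  then show "a = b" by (simp add: kron_z_def)
qed simp

lemma kron_bracket_smult_z:
  "kron_bracket n (a \<cdot>\<^sub>v kron_z n) x = (0\<^sub>v (2 * n + 1) :: 'a::field vec)"
  "kron_bracket n x (a \<cdot>\<^sub>v kron_z n) = (0\<^sub>v (2 * n + 1) :: 'a vec)"
proof -
  have coords: "e_coord n (a \<cdot>\<^sub>v kron_z n) i = 0" "f_coord n (a \<cdot>\<^sub>v kron_z n) i = 0"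
    if "i \<in> {1..n}" for i
    using that by (auto simp: e_coord_def f_coord_def kron_z_def)
  have coords_pred: "f_coord n (a \<cdot>\<^sub>v kron_z n) (i - 1) = 0" if "i \<in> {2..n}" for i
    by (rule coords) (use that in auto)
  have zero: "0 \<cdot>\<^sub>v kron_z n = (0\<^sub>v (2 * n + 1) :: 'a vec)"
    by (rule eq_vecI) (simp_all add: kron_z_def)
  show "kron_bracket n (a \<cdot>\<^sub>v kron_z n) x = 0\<^sub>v (2 * n + 1)"
    unfolding kron_bracket_def using coords_pred zero by (simp add: coords)
  show "kron_bracket n x (a \<cdot>\<^sub>v kron_z n) = 0\<^sub>v (2 * n + 1)"
    unfolding kron_bracket_def using coords_pred zero by (simp add: coords)
qed

text \<open>
  The Leibniz rule at \<open>(x, y)\<close> and at \<open>(y, x)\<close> gives the sum and the difference of a symmetric and an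
  alternating condition; this separates the two.
\<close>
lemma add_diff_eq_split:
  fixes a b u v :: "'a::field"
  assumes "(2::'a) \<noteq> 0"
  shows "u + v = a + b \<and> u - v = a - b \<longleftrightarrow> a = u \<and> b = v"
proof
  assume h: "u + v = a + b \<and> u - v = a - b"
  have "2 * a = (a + b) + (a - b)" "2 * b = (a + b) - (a - b)" by simp_all
  then have "2 * a = 2 * u" "2 * b = 2 * v"
    unfolding h[THEN conjunct1, symmetric] h[THEN conjunct2, symmetric] by simp_all
  then show "a = u \<and> b = v" using assms by simp
qed simp

text \<open>
  In each of the three systems the first equation says that \<open>d\<close> scales the symmetric part of the
  bracket by \<open>\<gamma>\<close>, and the second one says this for the alternating part. Pairs containing \<open>z\<close> give no
  condition once \<open>d z\<close> is a multiple of \<open>z\<close>, since \<open>z\<close> brackets to zero with everything.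
\<close>
lemma derivation_iff_block_equations:
  fixes d :: "'a::field vec \<Rightarrow> 'a vec"
  assumes two: "(2::'a) \<noteq> 0" and n: "n \<ge> 1"
    and d: "linear_map class_ring (kron_space n) (kron_space n) d"
    and A_def: "\<And>i j. A i j = pad n (e_coord n (d (kron_e n j))) i"
    and B_def: "\<And>i j. B i j = pad n (f_coord n (d (kron_e n j))) i"
    and C_def: "\<And>i j. C i j = pad n (e_coord n (d (kron_f n j))) i"
    and D_def: "\<And>i j. D i j = pad n (f_coord n (d (kron_f n j))) i"
  shows "derivation (kron_space n) (kron_bracket n) d \<longleftrightarrow>
    (\<exists>\<gamma>. d (kron_z n) = \<gamma> \<cdot>\<^sub>v kron_z n \<and>
      (\<forall>i\<in>{1..n}. \<forall>j\<in>{1..n}. A j i + D i j = (if i = j then \<gamma> else 0) \<and>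
         A (j + 1) i + D (i - 1) j = (if i = j + 1 then \<gamma> else 0)) \<and>
      (\<forall>i\<in>{1..n}. \<forall>j\<in>{1..n}. B i j + B j i = 0 \<and> B (i - 1) j = B (j - 1) i) \<and>
      (\<forall>i\<in>{1..n}. \<forall>j\<in>{1..n}. C i j + C j i = 0 \<and> C (j + 1) i = C (i + 1) j))"
proof -
  let ?O = "0\<^sub>v (2 * n + 1) :: 'a vec"
  have zero: "?O = 0 \<cdot>\<^sub>v kron_z n" by (rule eq_vecI) (simp_all add: kron_z_def)
  have add: "a \<cdot>\<^sub>v kron_z n + b \<cdot>\<^sub>v kron_z n = (a + b) \<cdot>\<^sub>v (kron_z n :: 'a vec)" for a b
    by (simp add: add_smult_distrib_vec)
  have uminus: "- v = (- 1) \<cdot>\<^sub>v v" for v :: "'a vec" by (rule eq_vecI) simp_all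
  have neg: "d (- kron_z n) = - d (kron_z n)"
    unfolding uminus by (rule kron_linear_map_simps(3)[OF d kron_basis_closed(3)])
  have d0: "d ?O = 0 \<cdot>\<^sub>v kron_z n" using kron_linear_map_simps(4)[OF d] zero by simp
  have ee: "leibniz_at n d (kron_e n i) (kron_e n j) \<longleftrightarrow>
      0 = (B i j + B j i) + (B (i - 1) j - B (j - 1) i)"
    if "i \<in> {1..n}" "j \<in> {1..n}" for i j
    unfolding leibniz_at_def kron_bracket_zero[OF that]
    unfolding bracket_with_basis[OF that(1)] bracket_with_basis[OF that(2)] d0 add kron_z_smult_eq_iff B_def by (simp add: algebra_simps)
  have ff: "leibniz_at n d (kron_f n i) (kron_f n j) \<longleftrightarrow>
      0 = (C i j + C j i) + (C (j + 1) i - C (i + 1) j)"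
    if "i \<in> {1..n}" "j \<in> {1..n}" for i j
    unfolding leibniz_at_def kron_bracket_zero[OF that]
    unfolding bracket_with_basis[OF that(1)] bracket_with_basis[OF that(2)] d0 add kron_z_smult_eq_iff C_def by (simp add: algebra_simps)
  have ef: "leibniz_at n d (kron_e n i) (kron_f n j) \<longleftrightarrow>
      d (if i = j \<or> i = j + 1 then kron_z n else ?O) =
        ((A j i + D i j) + (A (j + 1) i + D (i - 1) j)) \<cdot>\<^sub>v kron_z n"
    if "i \<in> {1..n}" "j \<in> {1..n}" for i j
    unfolding leibniz_at_def kron_bracket_e_f[OF that]
    unfolding bracket_with_basis[OF that(1)] bracket_with_basis[OF that(2)] add A_def D_def by (simp add: algebra_simps)
  have fe: "leibniz_at n d (kron_f n j) (kron_e n i) \<longleftrightarrow>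
      d (if i = j then kron_z n else if i = j + 1 then - kron_z n else ?O) =
        ((A j i + D i j) - (A (j + 1) i + D (i - 1) j)) \<cdot>\<^sub>v kron_z n"
    if "i \<in> {1..n}" "j \<in> {1..n}" for i j
    unfolding leibniz_at_def kron_bracket_f_e[OF that]
    unfolding bracket_with_basis[OF that(1)] bracket_with_basis[OF that(2)] add A_def D_def by (simp add: algebra_simps)
  have z: "leibniz_at n d (kron_z n) x" "leibniz_at n d x (kron_z n)"
    if "d (kron_z n) = \<gamma> \<cdot>\<^sub>v kron_z n" for \<gamma> x
    unfolding leibniz_at_def kron_bracket_z that kron_bracket_smult_z
    using kron_linear_map_simps(4)[OF d] by simp_all
  \<comment> \<open>\<open>d z\<close> stays on its line because \<open>z = [e\<^sub>1, f\<^sub>1]\<close> and the right side of the Leibniz rule is a sum of brackets.\<close>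
  have ex_z: "\<exists>\<gamma>. d (kron_z n) = \<gamma> \<cdot>\<^sub>v kron_z n" if "leibniz_at n d (kron_e n 1) (kron_f n 1)"
    using that ef[of 1 1] n by auto
  have sum_ef: "leibniz_at n d (kron_e n i) (kron_f n j) \<and> leibniz_at n d (kron_f n j) (kron_e n i)
      \<longleftrightarrow> A j i + D i j = (if i = j then \<gamma> else 0) \<and>
         A (j + 1) i + D (i - 1) j = (if i = j + 1 then \<gamma> else 0)"
    if "i \<in> {1..n}" "j \<in> {1..n}" and \<gamma>: "d (kron_z n) = \<gamma> \<cdot>\<^sub>v kron_z n" for i j \<gamma>
  proof -
    let ?u = "if i = j then \<gamma> else 0" and ?v = "if i = j + 1 then \<gamma> else 0"
    have "d (if i = j \<or> i = j + 1 then kron_z n else ?O) = (?u + ?v) \<cdot>\<^sub>v kron_z n"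
      using d0 by (auto simp: \<gamma>)
    moreover have "- (\<gamma> \<cdot>\<^sub>v kron_z n) = (- \<gamma>) \<cdot>\<^sub>v (kron_z n :: 'a vec)"
      by (rule eq_vecI) (simp_all add: kron_z_def)
    then have "d (if i = j then kron_z n else if i = j + 1 then - kron_z n else ?O)
        = (?u - ?v) \<cdot>\<^sub>v kron_z n"
      using d0 by (auto simp: \<gamma> neg)
    ultimately show ?thesis
      unfolding ef[OF that(1,2)] fe[OF that(1,2)]
      by (simp only: kron_z_smult_eq_iff add_diff_eq_split[OF two])
  qed
  have ee_sym: "(\<forall>i\<in>{1..n}. \<forall>j\<in>{1..n}. leibniz_at n d (kron_e n i) (kron_e n j)) \<longleftrightarrow>
      (\<forall>i\<in>{1..n}. \<forall>j\<in>{1..n}. B i j + B j i = 0 \<and> B (i - 1) j = B (j - 1) i)" 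
  proof -
    \<comment> \<open>Exchanging \<open>i\<close> and \<open>j\<close> keeps the symmetric part and negates the alternating one.\<close>
    have swap: "(B j i + B i j) + (B (j - 1) i - B (i - 1) j) = (B i j + B j i) - (B (i - 1) j - B (j - 1) i)" for i j
      by (simp add: algebra_simps)
    have "0 = (B i j + B j i) + (B (i - 1) j - B (j - 1) i) \<and>
        0 = (B j i + B i j) + (B (j - 1) i - B (i - 1) j) \<longleftrightarrow>
        B i j + B j i = 0 \<and> B (i - 1) j = B (j - 1) i" for i j
      unfolding swap[where i = i and j = j]
      using add_diff_eq_split[OF two, of 0 0 "B i j + B j i" "B (i - 1) j - B (j - 1) i"]
      by (simp only: add_0 diff_0_right right_minus_eq)
    then show ?thesis using ee by blast
  qed
  have ff_sym: "(\<forall>i\<in>{1..n}. \<forall>j\<in>{1..n}. leibniz_at n d (kron_f n i) (kron_f n j)) \<longleftrightarrow>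
      (\<forall>i\<in>{1..n}. \<forall>j\<in>{1..n}. C i j + C j i = 0 \<and> C (j + 1) i = C (i + 1) j)" 
  proof -
    \<comment> \<open>Exchanging \<open>i\<close> and \<open>j\<close> keeps the symmetric part and negates the alternating one.\<close>
    have swap: "(C j i + C i j) + (C (i + 1) j - C (j + 1) i) = (C i j + C j i) - (C (j + 1) i - C (i + 1) j)" for i j
      by (simp add: algebra_simps)
    have "0 = (C i j + C j i) + (C (j + 1) i - C (i + 1) j) \<and>
        0 = (C j i + C i j) + (C (i + 1) j - C (j + 1) i) \<longleftrightarrow>
        C i j + C j i = 0 \<and> C (j + 1) i = C (i + 1) j" for i j
      unfolding swap[where i = i and j = j]
      using add_diff_eq_split[OF two, of 0 0 "C i j + C j i" "C (j + 1) i - C (i + 1) j"]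
      by (simp only: add_0 diff_0_right right_minus_eq)
    then show ?thesis using ff by blast
  qed
  have "derivation (kron_space n) (kron_bracket n) d \<longleftrightarrow>
      (\<exists>\<gamma>. d (kron_z n) = \<gamma> \<cdot>\<^sub>v kron_z n) \<and>
      (\<forall>i\<in>{1..n}. \<forall>j\<in>{1..n}. leibniz_at n d (kron_e n i) (kron_f n j) \<and>
         leibniz_at n d (kron_f n j) (kron_e n i)) \<and>
      (\<forall>i\<in>{1..n}. \<forall>j\<in>{1..n}. leibniz_at n d (kron_e n i) (kron_e n j)) \<and>
      (\<forall>i\<in>{1..n}. \<forall>j\<in>{1..n}. leibniz_at n d (kron_f n i) (kron_f n j))"
    (is "?deriv \<longleftrightarrow> ?Z \<and> ?EF \<and> ?EE \<and> ?FF")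
  proof
    assume ?deriv
    then have "?EF \<and> ?EE \<and> ?FF" unfolding derivation_iff_leibniz_on_basis[OF d] by blast
    moreover from this have ?Z using ex_z n by auto
    ultimately show "?Z \<and> ?EF \<and> ?EE \<and> ?FF" by blast
  next
    assume "?Z \<and> ?EF \<and> ?EE \<and> ?FF"
    then show ?deriv unfolding derivation_iff_leibniz_on_basis[OF d] using z by blast
  qed
  then show ?thesis unfolding ee_sym ff_sym using sum_ef by blast
qed

section \<open>The matrix of a derivation\<close>

lemma all_kron_index_iff:
  fixes n :: nat
  shows "(\<forall>k < 2 * n + 1. P k) \<longleftrightarrow> (\<forall>i\<in>{1..n}. P (i - 1)) \<and> (\<forall>i\<in>{1..n}. P (n + i - 1)) \<and> P (2 * n)"
proof safe
  fix k
  assume "\<forall>i\<in>{1..n}. P (i - 1)" "\<forall>i\<in>{1..n}. P (n + i - 1)" "P (2 * n)" "k < 2 * n + 1"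
  then show "P k"
  proof (cases "k < n")
    case True
    then show ?thesis using \<open>\<forall>i\<in>{1..n}. P (i - 1)\<close>[rule_format, of "k + 1"] by simp
  next
    case False
    then show ?thesis
      using \<open>\<forall>i\<in>{1..n}. P (n + i - 1)\<close>[rule_format, of "k - n + 1"] \<open>P (2 * n)\<close> \<open>k < 2 * n + 1\<close>
      by (cases "k = 2 * n") auto
  qed
qed auto

lemma kron_matrix_index:
  assumes "r < 2 * n + 1" "c < 2 * n + 1"
  shows "kron_matrix n d $$ (r, c) = d (unit_vec (2 * n + 1) c) $ r"
proof -
  let ?cols = "map (\<lambda>i. d (kron_e n i)) [1..<n + 1] @ map (\<lambda>i. d (kron_f n i)) [1..<n + 1] @ [d (kron_z n)]"
  have "?cols ! c = d (unit_vec (2 * n + 1) c)"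
    using assms by (auto simp: nth_append kron_e_def kron_f_def kron_z_def simp del: upt_Suc
        intro!: arg_cong[of _ _ d] arg_cong[of _ _ "unit_vec (Suc (2 * n))"])
  then show ?thesis
    unfolding kron_matrix_def using assms by (subst mat_of_cols_index) auto
qed

text \<open>
  The zero block and \<open>\<gamma>\<close> together form the last column, hence amount to \<open>d z = \<gamma> z\<close>; the rest of
  the last row only records \<open>\<mu>\<close> and \<open>\<nu>\<close>.
\<close>
lemma kron_matrix_eq_blocks_iff:
  fixes d :: "'a::field vec \<Rightarrow> 'a vec"
  assumes d: "linear_map class_ring (kron_space n) (kron_space n) d"
    and \<mu>: "\<mu> \<in> carrier_vec n" and \<nu>: "\<nu> \<in> carrier_vec n"
  shows "kron_matrix n d =
      four_block_mat
        (four_block_mat (mat_from_one n a) (mat_from_one n c) (mat_from_one n b) (mat_from_one n e))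
        (0\<^sub>m (2 * n) 1)
        (mat_of_rows (2 * n) [\<mu> @\<^sub>v \<nu>])
        (mat 1 1 (\<lambda>_. \<gamma>)) \<longleftrightarrow>
    d (kron_z n) = \<gamma> \<cdot>\<^sub>v kron_z n \<and>
    (\<forall>i\<in>{1..n}. \<forall>j\<in>{1..n}.
       e_coord n (d (kron_e n j)) i = a i j \<and> f_coord n (d (kron_e n j)) i = b i j \<and>
       e_coord n (d (kron_f n j)) i = c i j \<and> f_coord n (d (kron_f n j)) i = e i j) \<and>
    (\<forall>j\<in>{1..n}. d (kron_e n j) $ (2 * n) = \<mu> $ (j - 1) \<and> d (kron_f n j) $ (2 * n) = \<nu> $ (j - 1))"
    (is "_ = ?N \<longleftrightarrow> _")
proof -
  have [simp]: "dim_vec \<mu> = n" "dim_vec \<nu> = n" using \<mu> \<nu> by auto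
  have N: "?N $$ (i - 1, j - 1) = a i j" "?N $$ (n + i - 1, j - 1) = b i j"
    "?N $$ (i - 1, n + j - 1) = c i j" "?N $$ (n + i - 1, n + j - 1) = e i j"
    if "i \<in> {1..n}" "j \<in> {1..n}" for i j
    using that by (auto simp: mat_from_one_def)
  have N_row: "?N $$ (2 * n, j - 1) = \<mu> $ (j - 1)" "?N $$ (2 * n, n + j - 1) = \<nu> $ (j - 1)"
    if "j \<in> {1..n}" for j
    using that by (auto simp: mat_from_one_def mat_of_rows_index)
  have N_col: "?N $$ (r, 2 * n) = (\<gamma> \<cdot>\<^sub>v kron_z n) $ r" if "r < 2 * n + 1" for r
    using that by (auto simp: mat_from_one_def kron_z_def)
  have cols: "kron_matrix n d $$ (r, j - 1) = d (kron_e n j) $ r"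
    "kron_matrix n d $$ (r, n + j - 1) = d (kron_f n j) $ r"
    if "r < 2 * n + 1" "j \<in> {1..n}" for r j
    using that by (auto simp: kron_matrix_index kron_e_def kron_f_def)
  have col_z: "kron_matrix n d $$ (r, 2 * n) = d (kron_z n) $ r" if "r < 2 * n + 1" for r
    using that by (auto simp: kron_matrix_index kron_z_def)
  have dims: "dim_row (kron_matrix n d) = 2 * n + 1" "dim_col (kron_matrix n d) = 2 * n + 1"
    "dim_row ?N = 2 * n + 1" "dim_col ?N = 2 * n + 1"
    by (simp_all add: kron_matrix_def mat_from_one_def)
  have "kron_matrix n d = ?N \<longleftrightarrow>
      (\<forall>s < 2 * n + 1. \<forall>r < 2 * n + 1. kron_matrix n d $$ (r, s) = ?N $$ (r, s))"
    unfolding mat_eq_iff dims by blast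
  also have "\<dots> \<longleftrightarrow>
      (\<forall>j\<in>{1..n}. \<forall>r < 2 * n + 1. d (kron_e n j) $ r = ?N $$ (r, j - 1)) \<and>
      (\<forall>j\<in>{1..n}. \<forall>r < 2 * n + 1. d (kron_f n j) $ r = ?N $$ (r, n + j - 1)) \<and>
      (\<forall>r < 2 * n + 1. d (kron_z n) $ r = (\<gamma> \<cdot>\<^sub>v kron_z n) $ r)"
    unfolding all_kron_index_iff[where P = "\<lambda>s. \<forall>r < 2 * n + 1. kron_matrix n d $$ (r, s) = ?N $$ (r, s)"]
    by (simp only: cols col_z N_col cong: ball_cong imp_cong)
  also have "(\<forall>r < 2 * n + 1. d (kron_z n) $ r = (\<gamma> \<cdot>\<^sub>v kron_z n) $ r) \<longleftrightarrow>
      d (kron_z n) = \<gamma> \<cdot>\<^sub>v kron_z n"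
    using kron_linear_map_simps(1)[OF d kron_basis_closed(3)] by (auto simp: vec_eq_iff kron_z_def)
  finally show ?thesis
    unfolding all_kron_index_iff e_coord_def f_coord_def
    by (simp only: N N_row ball_conj_distrib cong: ball_cong) blast
qed

theorem theorem3p1:
  fixes n :: nat and d :: "'a::field vec \<Rightarrow> 'a vec"
  assumes "CHAR('a) \<noteq> 2"
    and "n \<ge> 1"
    and "linear_map class_ring (kron_space n) (kron_space n) d"
  shows "derivation (kron_space n) (kron_bracket n) d \<longleftrightarrow>
    (\<exists>\<mu> \<in> carrier_vec n. \<exists>\<nu> \<in> carrier_vec n.
      \<exists>(\<alpha> :: nat \<Rightarrow> 'a) (\<beta>\<^sub>1 :: 'a) (b :: nat \<Rightarrow> 'a) (c :: nat \<Rightarrow> 'a) (\<gamma> :: 'a).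
        \<gamma> = \<alpha> 1 + \<beta>\<^sub>1 \<and>
        kron_matrix n d =
          four_block_mat
            (four_block_mat (block_A n \<alpha>) (block_C n c) (block_B n b) (block_D n \<alpha> \<beta>\<^sub>1))
            (0\<^sub>m (2 * n) 1)
            (mat_of_rows (2 * n) [\<mu> @\<^sub>v \<nu>])
            (mat 1 1 (\<lambda>_. \<gamma>)))"
proof -
  note d = assms(3)
  have two: "(2::'a) \<noteq> 0"
  proof
    assume "(2::'a) = 0"
    then have "of_nat 2 = (0::'a)" by simp
    then have "CHAR('a) dvd 2" by (simp only: of_nat_eq_0_iff_char_dvd)
    then have "CHAR('a) = 1 \<or> CHAR('a) = 2"
      using two_is_prime_nat unfolding prime_nat_iff by blast
    then show False using assms(1) by simp
  qed
  define A where "A i j = pad n (e_coord n (d (kron_e n j))) i" for i j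
  define B where "B i j = pad n (f_coord n (d (kron_e n j))) i" for i j
  define C where "C i j = pad n (e_coord n (d (kron_f n j))) i" for i j
  define D where "D i j = pad n (f_coord n (d (kron_f n j))) i" for i j
  note blocks = A_def B_def C_def D_def
  let ?a = "\<lambda>\<alpha> i j. if i \<le> j then \<alpha> (j - i + 1) else (0::'a)"
  let ?b = "\<lambda>b i j. if odd (i + j) \<and> i + j \<ge> n + 1 then (- 1) ^ (i + 1) * b (i + j) else (0::'a)"
  let ?c = "\<lambda>c i j. if odd (i + j) \<and> i + j \<le> n + 1 then (- 1) ^ (i + 1) * c (i + j) else (0::'a)"
  let ?e = "\<lambda>\<alpha> \<beta> i j. if i = j then \<beta> else if i > j then - \<alpha> (i - j + 1) else (0::'a)"
  have pads: "A (n + 1) j = 0" "D 0 j = 0" "B 0 j = 0" "C (n + 1) j = 0" for j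
    by (simp_all add: blocks pad_def)
  have deriv: "derivation (kron_space n) (kron_bracket n) d \<longleftrightarrow>
    (\<exists>\<gamma>. d (kron_z n) = \<gamma> \<cdot>\<^sub>v kron_z n \<and>
      (\<exists>\<alpha> \<beta>. \<gamma> = \<alpha> 1 + \<beta> \<and>
         (\<forall>i\<in>{1..n}. \<forall>j\<in>{1..n}. A i j = ?a \<alpha> i j \<and> D i j = ?e \<alpha> \<beta> i j)) \<and>
      (\<exists>b. \<forall>i\<in>{1..n}. \<forall>j\<in>{1..n}. B i j = ?b b i j) \<and>
      (\<exists>c. \<forall>i\<in>{1..n}. \<forall>j\<in>{1..n}. C i j = ?c c i j))"
    unfolding derivation_iff_block_equations[OF two assms(2) d blocks]
      toeplitz_pair_iff[where A = A and D = D, OF assms(2) pads(1,2)]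
      lower_hankel_iff[where M = B, OF two pads(3)] upper_hankel_iff[where M = C, OF two pads(4)]
    by (rule refl)
  define last_row where "last_row = (\<lambda>\<mu> \<nu>. \<forall>j\<in>{1..n}.
      d (kron_e n j) $ (2 * n) = \<mu> $ (j - 1) \<and> d (kron_f n j) $ (2 * n) = \<nu> $ (j - 1))"
  \<comment> \<open>The last row is unconstrained: any linear map has one, so \<open>\<mu>\<close> and \<open>\<nu>\<close> can always be read off.\<close>
  have row: "\<exists>\<mu>\<in>carrier_vec n. \<exists>\<nu>\<in>carrier_vec n. last_row \<mu> \<nu>"
    unfolding last_row_def
    by (intro bexI[of _ "vec n (\<lambda>k. d (kron_e n (k + 1)) $ (2 * n))"]
        bexI[of _ "vec n (\<lambda>k. d (kron_f n (k + 1)) $ (2 * n))"]) auto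
  have matrix: "kron_matrix n d =
          four_block_mat
            (four_block_mat (block_A n \<alpha>) (block_C n c) (block_B n b) (block_D n \<alpha> \<beta>))
            (0\<^sub>m (2 * n) 1)
            (mat_of_rows (2 * n) [\<mu> @\<^sub>v \<nu>])
            (mat 1 1 (\<lambda>_. \<gamma>)) \<longleftrightarrow>
      d (kron_z n) = \<gamma> \<cdot>\<^sub>v kron_z n \<and>
      (\<forall>i\<in>{1..n}. \<forall>j\<in>{1..n}. A i j = ?a \<alpha> i j \<and> D i j = ?e \<alpha> \<beta> i j) \<and>
      (\<forall>i\<in>{1..n}. \<forall>j\<in>{1..n}. B i j = ?b b i j) \<and>
      (\<forall>i\<in>{1..n}. \<forall>j\<in>{1..n}. C i j = ?c c i j) \<and> last_row \<mu> \<nu>"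
    if "\<mu> \<in> carrier_vec n" "\<nu> \<in> carrier_vec n" for \<mu> \<nu> \<alpha> \<beta> b c \<gamma>
  proof -
    have "A i j = e_coord n (d (kron_e n j)) i" "B i j = f_coord n (d (kron_e n j)) i"
      "C i j = e_coord n (d (kron_f n j)) i" "D i j = f_coord n (d (kron_f n j)) i"
      if "i \<in> {1..n}" for i j
      using that by (simp_all add: blocks pad_def)
    then show ?thesis
      unfolding block_A_def block_B_def block_C_def block_D_def
        kron_matrix_eq_blocks_iff[OF d that] last_row_def
      by (simp only: ball_conj_distrib cong: ball_cong) blast
  qed
  show ?thesis (is "_ \<longleftrightarrow> ?form")
  proof
    assume "derivation (kron_space n) (kron_bracket n) d"
    then obtain \<gamma> \<alpha> \<beta> b c where "d (kron_z n) = \<gamma> \<cdot>\<^sub>v kron_z n" and g: "\<gamma> = \<alpha> 1 + \<beta>"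
      and "\<forall>i\<in>{1..n}. \<forall>j\<in>{1..n}. A i j = ?a \<alpha> i j \<and> D i j = ?e \<alpha> \<beta> i j"
        "\<forall>i\<in>{1..n}. \<forall>j\<in>{1..n}. B i j = ?b b i j"
        "\<forall>i\<in>{1..n}. \<forall>j\<in>{1..n}. C i j = ?c c i j"
      unfolding deriv by (elim exE conjE)
    moreover obtain \<mu> \<nu> where "\<mu> \<in> carrier_vec n" "\<nu> \<in> carrier_vec n" "last_row \<mu> \<nu>"
      using row by blast
    ultimately show ?form
      by (intro bexI[of _ \<mu>] bexI[of _ \<nu>] exI[of _ \<alpha>] exI[of _ \<beta>] exI[of _ b] exI[of _ c]
          exI[of _ \<gamma>] conjI matrix[THEN iffD2]) assumption+
  next
    assume ?form
    then obtain \<mu> \<nu> \<alpha> \<beta> b c \<gamma> where row: "\<mu> \<in> carrier_vec n" "\<nu> \<in> carrier_vec n"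
      and g: "\<gamma> = \<alpha> 1 + \<beta>"
      and "kron_matrix n d = four_block_mat
            (four_block_mat (block_A n \<alpha>) (block_C n c) (block_B n b) (block_D n \<alpha> \<beta>))
            (0\<^sub>m (2 * n) 1) (mat_of_rows (2 * n) [\<mu> @\<^sub>v \<nu>]) (mat 1 1 (\<lambda>_. \<gamma>))"
      by (elim bexE exE conjE)
    from this(4)[unfolded matrix[OF row]] g
    show "derivation (kron_space n) (kron_bracket n) d"
      unfolding deriv
      by (elim conjE, intro exI[of _ \<gamma>] conjI exI[of _ \<alpha>] exI[of _ \<beta>] exI[of _ b] exI[of _ c]) assumption+
  qed
qed

end
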